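(* Let $\mathbf P=(P,\leq)$ be a poset, $a,b\in P$ with $a\leq b$, $x\in[a,b]$ and $y\in P$. Assume that $(a,y,b)$ is a modular triple of $\mathbf P$ and that $e$ is the greatest element of $L\big(U(a,y),b\big)=LU\big(a,L(y,b)\big)$. Then the following are equivalent: (i) $e\in R(a,b,x)$; (ii) $L\Big(U\big(a,L(y,b)\big),x\Big)=L(a)$ and $U\Big(x,L\big(U(a,y),b\big)\Big)=U(b)$.
   Context: In a poset $(P,\leq)$, for $A\subseteq P$ let $L(A)=\{p\in P\mid p\leq a\text{ for all }a\in A\}$ and $U(A)=\{p\in P\mid a\leq p\text{ for all }a\in A\}$. One writes $L(a)$ for $L(\{a\})$, $L(a,b)$ for $L(\{a,b\})$, $L(A,a)$ for $L(A\cup\{a\})$, $U(a,A)$ for $U(\{a\}\cup A)$, $LU(A)$ for $L(U(A))$, and similarly. For $a\leq b$ and $x\in[a,b]$, an element $z\in[a,b]$ is a relative complement of $x$ in $[a,b]$ if $U(x,z)=U(b)$ and $L(x,z)=L(a)$; $R(a,b,x)$ denotes the set of all such relative complements. A triple $(p,q,r)$ of elements of $P$ is a modular triple of $\mathbf P$ if $p\leq r$ and $L\big(U(p,q),r\big)=LU\big(p,L(q,r)\big)$. *)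

theory Defs
  imports "HOL-Algebra.Order"
begin

text \<open>
  The sets \<open>L(A)\<close> and \<open>U(A)\<close> of lower and upper bounds are the library's
  \<^const>\<open>Lower\<close> and \<^const>\<open>Upper\<close>.  The locale \<^locale>\<open>partial_order\<close> requires the
  built-in equivalence of the structure to be equality, so it describes ordinary posets.
\<close>

definition rel_complements :: "[('a, 'c) gorder_scheme, 'a, 'a, 'a] \<Rightarrow> 'a set"
  where "rel_complements P a b x =
    {z \<in> \<lbrace>a..b\<rbrace>\<^bsub>P\<^esub>. Upper P {x, z} = Upper P {b} \<and> Lower P {x, z} = Lower P {a}}"

definition modular_triple :: "[('a, 'c) gorder_scheme, 'a, 'a, 'a] \<Rightarrow> bool"
  where "modular_triple P p q r \<longleftrightarrow>
    p \<in> carrier P \<and> q \<in> carrier P \<and> r \<in> carrier P \<and> p \<sqsubseteq>\<^bsub>P\<^esub> r \<and>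
    Lower P (Upper P {p, q} \<union> {r}) = Lower P (Upper P ({p} \<union> Lower P {q, r}))"

end

theory Submission
  imports Defs
begin

text \<open>
  With \<open>S = L(U(a,y),b) = LU(a,L(y,b))\<close>, the greatest element \<open>e\<close> of \<open>S\<close> satisfies
  \<open>U(S) = U(e)\<close>, and \<open>ULU = U\<close> gives \<open>U(a,L(y,b)) = U(S) = U(e)\<close>. Hence the two sets in (ii)
  are \<open>L(x,e)\<close> and \<open>U(x,e)\<close>, and \<open>e \<in> [a,b]\<close> because \<open>a \<in> S\<close> and \<open>S\<close> lies below \<open>b\<close>.
\<close>

context partial_order
begin

text \<open>An upper bound of \<open>S\<close> lies above \<open>e\<close> because \<open>e\<close>
  belongs to \<open>S\<close>; transitivity through \<open>e\<close> gives the converse.\<close>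

lemma Upper_greatest:
  assumes "greatest L e S" and "S \<subseteq> carrier L"
  shows "Upper L S = Upper L {e}"
proof -
  have e: "e \<in> S" "e \<in> carrier L" "\<And>s. s \<in> S \<Longrightarrow> s \<sqsubseteq> e"
    using assms by (auto simp: greatest_def)
  show ?thesis
  proof (intro equalityI subsetI)
    fix u assume "u \<in> Upper L S"
    then show "u \<in> Upper L {e}"
      using e(1,2) by (auto simp: Upper_def)
  next
    fix u assume "u \<in> Upper L {e}"
    then have "u \<in> carrier L" "e \<sqsubseteq> u"
      using e(2) by (auto simp: Upper_def)
    then show "u \<in> Upper L S"
      unfolding Upper_def using e assms(2) by (blast intro: le_trans)
  qed
qed

text \<open>Galois connection: \<open>A\<close> lies in LU(A), and each element of U(A) bounds LU(A)
  from above.\<close>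

lemma Upper_Lower_Upper:
  assumes "A \<subseteq> carrier L"
  shows "Upper L (Lower L (Upper L A)) = Upper L A"
  using assms unfolding Upper_def Lower_def by blast

lemma Upper_Un: "Upper L (A \<union> B) = Upper L A \<inter> Upper L B"
  by (auto simp: Upper_def)

lemma Lower_Un: "Lower L (A \<union> B) = Lower L A \<inter> Lower L B"
  by (auto simp: Lower_def)

text \<open>Since \<open>e\<close> itself is in U(e), a lower bound of U(e) is below
  \<open>e\<close>.\<close>

lemma Lower_Upper_singleton:
  assumes "e \<in> carrier L"
  shows "Lower L (Upper L {e}) = Lower L {e}"
  using assms unfolding Upper_def Lower_def by (blast intro: le_trans le_refl)

end

theorem theorem6:
  fixes P (structure) and a b x y e :: 'a
  assumes "partial_order P"
    and "a \<in> carrier P" and "b \<in> carrier P" and "a \<sqsubseteq> b"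
    and "x \<in> \<lbrace>a..b\<rbrace>" and "y \<in> carrier P"
    and "modular_triple P a y b"
    and "greatest P e (Lower P (Upper P {a, y} \<union> {b}))"
  shows "e \<in> rel_complements P a b x \<longleftrightarrow>
    Lower P (Upper P ({a} \<union> Lower P {y, b}) \<union> {x}) = Lower P {a} \<and>
    Upper P ({x} \<union> Lower P (Upper P {a, y} \<union> {b})) = Upper P {b}"
proof -
  interpret partial_order P by fact
  let ?S = "Lower P (Upper P {a, y} \<union> {b})" and ?A = "{a} \<union> Lower P {y, b}"
  have e: "e \<in> ?S" "e \<in> carrier P"
    using assms(8) by (auto simp: greatest_def Lower_def)
  have "a \<in> ?S"
    using assms(2,4) by (auto simp: Lower_def Upper_def)
  then have "a \<sqsubseteq> e"
    using assms(8) by (simp add: greatest_def)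
  moreover have "e \<sqsubseteq> b"
    using e assms(3) by (auto simp: Lower_def)
  ultimately have interval: "e \<in> \<lbrace>a..b\<rbrace>"
    using e(2) by (simp add: at_least_at_most_def)
  have US: "Upper P ?S = Upper P {e}"
    by (rule Upper_greatest[OF assms(8)]) simp
  have "Upper P ?A = Upper P (Lower P (Upper P ?A))"
    by (rule Upper_Lower_Upper[symmetric]) (use assms(2) in simp)
  \<comment> \<open>The modular triple enters only here.\<close>
  also have "Lower P (Upper P ?A) = ?S"
    using assms(7) by (simp add: modular_triple_def)
  finally have UA: "Upper P ?A = Upper P {e}"
    using US by simp
  have "Lower P (Upper P ?A \<union> {x}) = Lower P ({x} \<union> {e})"
    unfolding Lower_Un UA Lower_Upper_singleton[OF e(2)] by (rule Int_commute)
  moreover have "Upper P ({x} \<union> ?S) = Upper P ({x} \<union> {e})"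
    by (simp only: Upper_Un US)
  moreover have "{x} \<union> {e} = {x, e}"
    by blast
  \<comment> \<open>As \<open>e\<close> lies in the interval, membership in
    \<open>rel_complements\<close> reduces to the two equations for \<open>{x, e}\<close>.\<close>
  ultimately show ?thesis
    unfolding rel_complements_def mem_Collect_eq using interval by metis
qed

end
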